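(* Let $0\le p\le q$ be integers and suppose that the positive parameters $(a_1,\dots,a_p)$, $(b_1,\dots,b_q)$ satisfy condition (S) or condition (M) stated in the context. (1) The function (where $p=q$) $$\mu\mapsto{}_{q+2}F_{q+1}(\mu/2,\mu/2+1/2,b_1,\dots,b_q;\,1/2,a_1,\dots,a_q;\,x)$$ is coefficient-wise log-convex for $\mu>0$. (2) The function $$\mu\mapsto(\mu)_2\cdot{}_{p+2}F_{q+1}(\mu/2+1,\mu/2+3/2,a_1,\dots,a_p;\,3/2,b_1,\dots,b_q;\,x)$$ with $p\le q$ is coefficient-wise log-concave for $\mu>0$.
   Context: $(\mu)_n$ is the rising factorial: $(\mu)_0=1$, $(\mu)_n=\mu(\mu+1)\cdots(\mu+n-1)$. ${}_sF_t(c_1,\dots,c_s;d_1,\dots,d_t;x)=\sum_{n\ge0}\frac{(c_1)_n\cdots(c_s)_n}{(d_1)_n\cdots(d_t)_n\,n!}x^n$ is the generalized hypergeometric series. Let $e_k$ be the $k$-th elementary symmetric polynomial ($e_0=1$), and write $e_k(a)=e_k(a_1,\dots,a_p)$, $e_k(b)=e_k(b_1,\dots,b_q)$. Condition (S): $$\frac{e_q(b)}{e_p(a)}\le\frac{e_{q-1}(b)}{e_{p-1}(a)}\le\cdots\le\frac{e_{q-p+1}(b)}{e_1(a)}\le e_{q-p}(b).$$ Condition (M): for some $p$-dimensional sub-vector $(b_{n_1},\dots,b_{n_p})$ of $(b_1,\dots,b_q)$ one has $\sum_{j=1}^kb_{n_j}\le\sum_{j=1}^ka_j$ for $k=1,\dots,p$.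 For a formal power series $f(\mu;x)$ in $x$ put $\Delta_f(\alpha,\beta;x)=f(\mu+\alpha;x)f(\mu+\beta;x)-f(\mu;x)f(\mu+\alpha+\beta;x)=\sum_k\delta_kx^k$. It is coefficient-wise log-concave (log-convex) for $\mu>0$ if $\delta_k\ge0$ ($\delta_k\le0$) for all $k\ge0$, $\mu>0$, $\alpha,\beta\ge0$.
   Formalization: In condition (M) the parameters a are taken in nondecreasing order (the usual majorization convention); for an arbitrary ordering of a the claim is false, e.g. a=(10,1/100), b=(1,9), μ=α=β=1 gives δ_2>0 in part (1). *)

theory Defs
  imports "HOL-Computational_Algebra.Formal_Power_Series"
begin

text \<open>
  Parameter vectors are lists. In the elementary symmetric polynomial the sum runs over sets of
  positions, so that repeated entries are counted with multiplicity.
\<close>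

definition esym :: "nat \<Rightarrow> real list \<Rightarrow> real" where
  "esym k xs = (\<Sum>I | I \<subseteq> {..<length xs} \<and> card I = k. \<Prod>i\<in>I. xs ! i)"

text \<open>
  The chain \<open>e\<^sub>q(b) / e\<^sub>p(a) \<le> e\<^sub>q\<^sub>-\<^sub>1(b) / e\<^sub>p\<^sub>-\<^sub>1(a) \<le> \<dots> \<le> e\<^sub>q\<^sub>-\<^sub>p(b)\<close>, whose last member is
  \<open>e\<^sub>q\<^sub>-\<^sub>p(b) / e\<^sub>0(a)\<close> with \<open>e\<^sub>0(a) = 1\<close>. Only used for \<open>length a \<le> length b\<close>.
\<close>

definition cond_S :: "real list \<Rightarrow> real list \<Rightarrow> bool" where
  "cond_S a b \<longleftrightarrow>
     (let p = length a; q = length b in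
       \<forall>k<p. esym (q - k) b / esym (p - k) a \<le> esym (q - (k + 1)) b / esym (p - (k + 1)) a)"

text \<open>
  Weak supermajorization by a sub-vector of \<open>b\<close>, given by a list \<open>ns\<close> of distinct positions.
  As usual for majorization, the partial sums of \<open>a\<close> are those of its nondecreasing rearrangement
  (the convention \<open>a\<^sub>1 \<le> \<dots> \<le> a\<^sub>p\<close>). Without it the condition would depend on the
  numbering of the parameters, although the hypergeometric series does not, and would be too weak:
  \<open>a = (10, 1/100)\<close>, \<open>b = (1, 9)\<close> satisfies the inequalities in the given order, but neither
  series has the asserted property. No order is imposed on \<open>ns\<close>: sorting the selected
  entries increasingly only decreases their partial sums.
\<close>

definition cond_M :: "real list \<Rightarrow> real list \<Rightarrow> bool" where
  "cond_M a b \<longleftrightarrow>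
     (\<exists>ns. length ns = length a \<and> distinct ns \<and> set ns \<subseteq> {..<length b} \<and>
        (\<forall>k\<in>{1..length a}. (\<Sum>j<k. b ! (ns ! j)) \<le> (\<Sum>j<k. sort a ! j)))"

definition gen_Turanian :: "(real \<Rightarrow> real fps) \<Rightarrow> real \<Rightarrow> real \<Rightarrow> real \<Rightarrow> real fps" where
  "gen_Turanian f \<mu> \<alpha> \<beta> = f (\<mu> + \<alpha>) * f (\<mu> + \<beta>) - f \<mu> * f (\<mu> + \<alpha> + \<beta>)"

definition coeffwise_log_concave :: "(real \<Rightarrow> real fps) \<Rightarrow> bool" where
  "coeffwise_log_concave f \<longleftrightarrow>
     (\<forall>k. \<forall>\<mu>>0. \<forall>\<alpha>\<ge>0. \<forall>\<beta>\<ge>0. fps_nth (gen_Turanian f \<mu> \<alpha> \<beta>) k \<ge> 0)"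

definition coeffwise_log_convex :: "(real \<Rightarrow> real fps) \<Rightarrow> bool" where
  "coeffwise_log_convex f \<longleftrightarrow>
     (\<forall>k. \<forall>\<mu>>0. \<forall>\<alpha>\<ge>0. \<forall>\<beta>\<ge>0. fps_nth (gen_Turanian f \<mu> \<alpha> \<beta>) k \<le> 0)"

end

theory Submission
  imports Defs
begin

text \<open>
  By the duplication formula the coefficients of the two series are \<open>r\<^sub>n (\<mu>)\<^sub>2\<^sub>n / (2n)!\<close> and
  \<open>r\<^sub>n (\<mu>)\<^sub>2\<^sub>n\<^sub>+\<^sub>2 / (2n+1)!\<close>. Condition (S) or (M) makes \<open>\<Prod>(b\<^sub>i + t) / \<Prod>(a\<^sub>i + t)\<close> increasing in
  \<open>t \<ge> 0\<close>, so \<open>r\<close> is log-convex in the first case and log-concave in the second, and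
  \<open>r\<^sub>i r\<^sub>k\<^sub>-\<^sub>i\<close> is monotone from \<open>i = 0\<close> towards the middle \<open>i = k/2\<close>. These products weight the terms
  that make up \<open>\<delta>\<^sub>k\<close>. After symmetrization under \<open>i \<mapsto> k - i\<close> the terms change sign at most
  once, from negative to positive, on the way to the middle. Hence it suffices to know the sign of
  the unweighted sum, i.e. the case \<open>r = 1\<close>. Then the series are, up to a factor, the even part of
  \<open>A\<^sup>\<mu>\<close> and the odd part of \<open>\<mu> A\<^sup>\<mu>\<^sup>+\<^sup>1\<close>, where \<open>A = 1/(1-y)\<close>, \<open>B = 1/(1+y)\<close> and \<open>x = y\<^sup>2\<close>,
  and the Turanians are explicit combinations of \<open>A\<^sup>c - B\<^sup>c\<close> and \<open>(AB)\<^sup>c\<close>, whose coefficients are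
  nonnegative.
\<close>

unbundle fps_syntax

subsection \<open>Sign changes of the symmetrized terms\<close>

text \<open>The product condition and \<open>0 \<le> (q1 - p1) * (q1 - p2)\<close> yield
  \<open>p1 + p2 \<le> q1 + q2\<close>. Measure each factor by its deficit from the largest factor
  \<open>q1\<close>. The common part \<open>q1\<close> is settled by
  \<open>P1 + P2 \<le> Q1 + Q2\<close>. As \<open>Q2\<close> bounds \<open>P1\<close> and
  \<open>P2\<close> from below, the deficits on the left weigh at least
  \<open>(q1 - p1 + q1 - p2) * Q2\<close>, hence at least \<open>(q1 - q2) * Q2\<close>.\<close>

lemma dominance_step:
  fixes P1 P2 Q1 Q2 p1 p2 q1 q2 :: real
  assumes "0 \<le> Q2" "Q2 \<le> P1" "Q2 \<le> P2" "0 < q1" "p1 \<le> q1" "p2 \<le> q1"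
    and "p1 * p2 \<le> q1 * q2" and "P1 + P2 \<le> Q1 + Q2"
  shows "P1 * p1 + P2 * p2 \<le> Q1 * q1 + Q2 * q2"
proof -
  have "0 \<le> (q1 - p1) * (q1 - p2)" using assms by simp
  also have "\<dots> \<le> q1 * (q1 + q2 - p1 - p2)" using assms(7) by (simp add: algebra_simps)
  finally have "0 \<le> q1 + q2 - p1 - p2" using assms(4) by (simp add: zero_le_mult_iff)
  then have "0 \<le> Q2 * (q1 + q2 - p1 - p2)" using assms(1) by simp
  also have "\<dots> = (q1 - p1) * Q2 + (q1 - p2) * Q2 - (q1 - q2) * Q2"
    by (simp add: algebra_simps)
  also have "\<dots> \<le> (q1 - p1) * P1 + (q1 - p2) * P2 - (q1 - q2) * Q2"
    using assms by (intro diff_right_mono add_mono mult_left_mono) auto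
  also have "\<dots> = q1 * (P1 + P2) - p1 * P1 - p2 * P2 - (q1 - q2) * Q2"
    by (simp add: algebra_simps)
  also have "\<dots> \<le> q1 * (Q1 + Q2) - p1 * P1 - p2 * P2 - (q1 - q2) * Q2"
    using assms by simp
  finally show ?thesis by (simp add: algebra_simps)
qed

text \<open>For \<open>m = n\<close> the factors compare one by one, with difference
  \<open>\<alpha> * \<beta>\<close>; each further step in \<open>m\<close> multiplies by
  \<open>x + m\<close> on the left and by the larger \<open>x + \<beta> + m\<close> on the right.
  This provides the bounds \<open>Q2 \<le> P1\<close> and \<open>Q2 \<le> P2\<close> of
  \<open>dominance_step\<close>.\<close>

lemma pochhammer_cross_le:
  fixes x \<alpha> \<beta> :: real
  assumes "0 < x" "0 \<le> \<alpha>" "0 \<le> \<beta>" "n \<le> m"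
  shows "pochhammer x m * pochhammer (x + \<alpha> + \<beta>) n \<le> pochhammer (x + \<alpha>) n * pochhammer (x + \<beta>) m"
  using assms(4)
proof (induction m rule: dec_induct)
  case base
  show ?case unfolding pochhammer_prod prod.distrib[symmetric]
  proof (intro prod_mono conjI)
    fix i
    have "0 \<le> \<alpha> * \<beta>" using assms by simp
    then show "(x + real i) * (x + \<alpha> + \<beta> + real i) \<le> (x + \<alpha> + real i) * (x + \<beta> + real i)"
      by (simp add: algebra_simps)
    show "0 \<le> (x + real i) * (x + \<alpha> + \<beta> + real i)" using assms by simp
  qed
next
  case (step m)
  have "(x + real m) * (pochhammer x m * pochhammer (x + \<alpha> + \<beta>) n)
      \<le> (x + \<beta> + real m) * (pochhammer (x + \<alpha>) n * pochhammer (x + \<beta>) m)"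
    by (rule mult_mono[OF _ step.IH]) (use assms in \<open>auto intro!: mult_nonneg_nonneg pochhammer_nonneg\<close>)
  then show ?case by (simp add: pochhammer_rec' mult_ac)
qed

text \<open>
  Passing from \<open>(n + 1, m)\<close> to \<open>(n, m + 1)\<close> multiplies each of the four products by a quotient;
  these quotients play the role of \<open>p1, p2, q1, q2\<close> in \<open>dominance_step\<close>.
\<close>

lemma pochhammer_turan_step:
  fixes x \<alpha> \<beta> :: real
  defines "T \<equiv> \<lambda>n m. pochhammer (x + \<alpha>) n * pochhammer (x + \<beta>) m
                + pochhammer (x + \<alpha>) m * pochhammer (x + \<beta>) n
                - pochhammer x n * pochhammer (x + \<alpha> + \<beta>) m
                - pochhammer x m * pochhammer (x + \<alpha> + \<beta>) n"
  assumes x: "0 < x" and ab: "0 \<le> \<alpha>" "0 \<le> \<beta>" and nm: "n < m" and T: "T (Suc n) m \<le> 0"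
  shows "T n (Suc m) \<le> 0"
proof -
  define N M where "N = x + real n" and "M = x + real m"
  have pos: "0 < N" "N \<le> M" "0 < M" using x nm by (auto simp: N_def M_def)
  have "pochhammer (x + \<alpha>) (Suc n) * pochhammer (x + \<beta>) m * ((M + \<beta>) / (N + \<alpha>))
      + pochhammer (x + \<alpha>) m * pochhammer (x + \<beta>) (Suc n) * ((M + \<alpha>) / (N + \<beta>))
      \<le> pochhammer x (Suc n) * pochhammer (x + \<alpha> + \<beta>) m * ((M + \<alpha> + \<beta>) / N)
      + pochhammer x m * pochhammer (x + \<alpha> + \<beta>) (Suc n) * (M / (N + \<alpha> + \<beta>))"
  proof (rule dominance_step)
    show "0 \<le> pochhammer x m * pochhammer (x + \<alpha> + \<beta>) (Suc n)"
      using x ab by (intro mult_nonneg_nonneg pochhammer_nonneg) auto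
    show "pochhammer x m * pochhammer (x + \<alpha> + \<beta>) (Suc n)
        \<le> pochhammer (x + \<alpha>) (Suc n) * pochhammer (x + \<beta>) m"
      using pochhammer_cross_le[of x \<alpha> \<beta> "Suc n" m] x ab nm by simp
    show "pochhammer x m * pochhammer (x + \<alpha> + \<beta>) (Suc n)
        \<le> pochhammer (x + \<alpha>) m * pochhammer (x + \<beta>) (Suc n)"
      using pochhammer_cross_le[of x \<beta> \<alpha> "Suc n" m] x ab nm by (simp add: ac_simps)
    show "0 < (M + \<alpha> + \<beta>) / N" using pos ab by simp
    show "(M + \<beta>) / (N + \<alpha>) \<le> (M + \<alpha> + \<beta>) / N" "(M + \<alpha>) / (N + \<beta>) \<le> (M + \<alpha> + \<beta>) / N"
      using pos ab by (auto intro!: frac_le)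
    \<comment> \<open>Both products of quotients depend on \<alpha> and \<beta> only through their
      sum \<open>s\<close> and product \<open>t\<close>; the claim becomes
      \<open>(U + t) / (V + t) \<le> U / V\<close>, which follows from
      \<open>V \<le> U\<close>.\<close>
    define s t U V where "s = \<alpha> + \<beta>" and "t = \<alpha> * \<beta>" and "U = M * (M + s)" and "V = N * (N + s)"
    have UV: "0 < V" "V \<le> U" "0 \<le> t" "0 \<le> s"
      using pos ab unfolding U_def V_def s_def t_def by (auto intro!: mult_mono mult_pos_pos)
    have "(U + t) / (V + t) \<le> U / V"
      using UV mult_right_mono[of V U t] by (simp add: divide_simps algebra_simps)
    moreover have "(M + \<beta>) * (M + \<alpha>) = U + t" "(N + \<alpha>) * (N + \<beta>) = V + t"
      "(M + \<alpha> + \<beta>) * M = U" "N * (N + \<alpha> + \<beta>) = V"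
      by (simp_all add: U_def V_def s_def t_def algebra_simps)
    ultimately show "(M + \<beta>) / (N + \<alpha>) * ((M + \<alpha>) / (N + \<beta>))
        \<le> (M + \<alpha> + \<beta>) / N * (M / (N + \<alpha> + \<beta>))"
      by (simp only: times_divide_times_eq)
  next
    show "pochhammer (x + \<alpha>) (Suc n) * pochhammer (x + \<beta>) m
        + pochhammer (x + \<alpha>) m * pochhammer (x + \<beta>) (Suc n)
        \<le> pochhammer x (Suc n) * pochhammer (x + \<alpha> + \<beta>) m
        + pochhammer x m * pochhammer (x + \<alpha> + \<beta>) (Suc n)"
      using T by (simp add: T_def)
  qed
  moreover have s: "pochhammer (x + \<alpha>) (Suc n) = (N + \<alpha>) * pochhammer (x + \<alpha>) n"
    "pochhammer (x + \<beta>) (Suc n) = (N + \<beta>) * pochhammer (x + \<beta>) n"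
    "pochhammer x (Suc n) = N * pochhammer x n"
    "pochhammer (x + \<alpha> + \<beta>) (Suc n) = (N + \<alpha> + \<beta>) * pochhammer (x + \<alpha> + \<beta>) n"
    "pochhammer (x + \<alpha>) (Suc m) = (M + \<alpha>) * pochhammer (x + \<alpha>) m"
    "pochhammer (x + \<beta>) (Suc m) = (M + \<beta>) * pochhammer (x + \<beta>) m"
    "pochhammer x (Suc m) = M * pochhammer x m"
    "pochhammer (x + \<alpha> + \<beta>) (Suc m) = (M + \<alpha> + \<beta>) * pochhammer (x + \<alpha> + \<beta>) m"
    by (simp_all add: pochhammer_rec' N_def M_def)
  have "N \<noteq> 0" "N + \<alpha> \<noteq> 0" "N + \<beta> \<noteq> 0" "N + \<alpha> + \<beta> \<noteq> 0"
    using pos ab by auto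
  then have "pochhammer (x + \<alpha>) (Suc n) * pochhammer (x + \<beta>) m * ((M + \<beta>) / (N + \<alpha>))
      = pochhammer (x + \<alpha>) n * pochhammer (x + \<beta>) (Suc m)"
    "pochhammer (x + \<alpha>) m * pochhammer (x + \<beta>) (Suc n) * ((M + \<alpha>) / (N + \<beta>))
      = pochhammer (x + \<alpha>) (Suc m) * pochhammer (x + \<beta>) n"
    "pochhammer x (Suc n) * pochhammer (x + \<alpha> + \<beta>) m * ((M + \<alpha> + \<beta>) / N)
      = pochhammer x n * pochhammer (x + \<alpha> + \<beta>) (Suc m)"
    "pochhammer x m * pochhammer (x + \<alpha> + \<beta>) (Suc n) * (M / (N + \<alpha> + \<beta>))
      = pochhammer x (Suc m) * pochhammer (x + \<alpha> + \<beta>) n"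
    unfolding s by (simp_all add: mult_ac)
  ultimately show ?thesis unfolding T_def by linarith
qed

text \<open>A Chebyshev-type argument: if \<open>T\<close> changes sign at \<open>j\<close> on the
  lower half, then \<open>G i - G j\<close> and \<open>T i\<close> never have opposite signs, and
  symmetry carries this to the upper half. Later only the sign of \<open>G j\<close> matters, so
  \<open>j\<close> may stay existential.\<close>

lemma single_crossing_weights:
  fixes G T :: "nat \<Rightarrow> real"
  assumes "\<And>i. i \<le> k \<Longrightarrow> G (k - i) = G i" "\<And>i. i \<le> k \<Longrightarrow> T (k - i) = T i"
    and G: "\<And>i. 2 * i + 1 < k \<Longrightarrow> G i \<le> G (Suc i)"
    and T: "\<And>i. 2 * i + 1 < k \<Longrightarrow> T (Suc i) \<le> 0 \<Longrightarrow> T i \<le> 0"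
  shows "\<exists>j\<le>k. G j * (\<Sum>i\<le>k. T i) \<le> (\<Sum>i\<le>k. G i * T i)"
proof -
  have Gmono: "G i \<le> G j" if "i \<le> j" "2 * j \<le> k" for i j
    using that
  proof (induction j rule: dec_induct)
    case (step j) then show ?case using G[of j] by simp
  qed simp
  have Tmono: "T i \<le> 0" if "i \<le> j" "2 * j \<le> k" "T j \<le> 0" for i j
    using that
  proof (induction j rule: dec_induct)
    case (step j) then show ?case using T[of j] by simp
  qed simp
  \<comment> \<open>The first index in the lower half with \<open>T\<close> positive; if there is
    none, the midpoint \<open>k div 2\<close>, beyond which the lower half is empty.\<close>
  obtain j where j: "2 * j \<le> k" "\<And>i. i < j \<Longrightarrow> T i \<le> 0"
    "\<And>i. j < i \<Longrightarrow> 2 * i \<le> k \<Longrightarrow> 0 \<le> T i"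
  proof (cases "\<exists>i. 2 * i \<le> k \<and> 0 < T i")
    case True
    define j where "j = (LEAST i. 2 * i \<le> k \<and> 0 < T i)"
    have j: "2 * j \<le> k \<and> 0 < T j" unfolding j_def by (rule LeastI_ex) (use True in simp)
    have "T i \<le> 0" if "i < j" for i
      using not_less_Least[of i "\<lambda>i. 2 * i \<le> k \<and> 0 < T i"] that j by (auto simp: j_def[symmetric])
    moreover have "0 \<le> T i" if "j < i" "2 * i \<le> k" for i
      using Tmono[of j i] that j by linarith
    ultimately show ?thesis using that[of j] j by blast
  next
    case False
    show ?thesis
      by (rule that[of "k div 2"]) (use False in \<open>auto simp: not_less\<close>)
  qed
  have low: "0 \<le> (G i - G j) * T i" if "2 * i \<le> k" for i
    using that Gmono[of i j] Gmono[of j i] j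
    by (cases i j rule: linorder_cases) (auto intro: mult_nonneg_nonneg mult_nonpos_nonpos)
  have "0 \<le> (G i - G j) * T i" if "i \<le> k" for i
    using low[of i] low[of "k - i"] assms(1,2)[of i] that by (cases "2 * i \<le> k") auto
  then have "0 \<le> (\<Sum>i\<le>k. (G i - G j) * T i)" by (intro sum_nonneg) auto
  also have "\<dots> = (\<Sum>i\<le>k. G i * T i) - G j * (\<Sum>i\<le>k. T i)"
    by (simp add: left_diff_distrib sum_subtractf sum_distrib_left)
  finally show ?thesis using j(1) by (intro exI[of _ j]) auto
qed

subsection \<open>The unweighted sums\<close>

lemma fps_even_mult_nth:
  fixes f g :: "real fps"
  assumes "\<And>n. odd n \<Longrightarrow> f $ n = 0"
  shows "(f * g) $ (2 * k) = (\<Sum>i\<le>k. f $ (2 * i) * g $ (2 * (k - i)))"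
proof -
  have "(f * g) $ (2 * k) = (\<Sum>i\<in>(*) 2 ` {..k}. f $ i * g $ (2 * k - i))"
    unfolding fps_mult_nth
  proof (rule sum.mono_neutral_right)
    show "\<forall>i\<in>{0..2 * k} - (*) 2 ` {..k}. f $ i * g $ (2 * k - i) = 0"
    proof
      fix i assume "i \<in> {0..2 * k} - (*) 2 ` {..k}"
      then have "odd i" by (auto elim!: evenE)
      then show "f $ i * g $ (2 * k - i) = 0" using assms by simp
    qed
  qed auto
  also have "\<dots> = (\<Sum>i\<le>k. f $ (2 * i) * g $ (2 * (k - i)))"
    by (subst sum.reindex) (auto simp: inj_on_def right_diff_distrib')
  finally show ?thesis .
qed

lemma fps_odd_mult_nth:
  fixes f g :: "real fps"
  assumes "\<And>n. even n \<Longrightarrow> f $ n = 0"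
  shows "(f * g) $ (2 * k + 2) = (\<Sum>i\<le>k. f $ (2 * i + 1) * g $ (2 * (k - i) + 1))"
proof -
  have "(f * g) $ (2 * k + 2) = (\<Sum>i\<in>(\<lambda>i. 2 * i + 1) ` {..k}. f $ i * g $ (2 * k + 2 - i))"
    unfolding fps_mult_nth
  proof (rule sum.mono_neutral_right)
    show "\<forall>i\<in>{0..2 * k + 2} - (\<lambda>i. 2 * i + 1) ` {..k}. f $ i * g $ (2 * k + 2 - i) = 0"
    proof
      fix i assume "i \<in> {0..2 * k + 2} - (\<lambda>i. 2 * i + 1) ` {..k}"
      then have "even i" by (cases "even i") (auto elim!: oddE simp: image_iff)
      then show "f $ i * g $ (2 * k + 2 - i) = 0" using assms by simp
    qed
  qed auto
  also have "\<dots> = (\<Sum>i\<le>k. f $ (2 * i + 1) * g $ (2 * k + 2 - (2 * i + 1)))"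
    by (subst sum.reindex) (auto simp: inj_on_def)
  also have "\<dots> = (\<Sum>i\<le>k. f $ (2 * i + 1) * g $ (2 * (k - i) + 1))"
    by (intro sum.cong refl arg_cong2[where f="(*)"] arg_cong[where f="fps_nth g"]) auto
  finally show ?thesis .
qed

text \<open>The expansion of \<open>(1 - s X)\<^sup>-\<^sup>c\<close>.\<close>

definition bser :: "real \<Rightarrow> real \<Rightarrow> real fps" where
  "bser s c = Abs_fps (\<lambda>n. s ^ n * pochhammer c n / fact n)"

text \<open>Vandermonde's identity for rising factorials, read as the exponent law for the binomial
  series.\<close>

lemma bser_add: "bser s (c + d) = bser s c * bser s d"
proof (rule fps_ext)
  fix n
  have "bser s (c + d) $ n
      = (\<Sum>i\<le>n. s ^ n * (of_nat (n choose i) * pochhammer c i * pochhammer d (n - i)) / fact n)"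
    by (simp add: bser_def pochhammer_binomial_sum sum_distrib_left sum_divide_distrib)
  also have "\<dots> = (\<Sum>i\<le>n. s ^ i * pochhammer c i / fact i * (s ^ (n - i) * pochhammer d (n - i) / fact (n - i)))"
  proof (rule sum.cong)
    fix i assume "i \<in> {..n}"
    then have "s ^ n = s ^ i * s ^ (n - i)" "real (n choose i) = fact n / (fact i * fact (n - i))"
      by (simp_all flip: power_add add: binomial_fact)
    then show "s ^ n * (of_nat (n choose i) * pochhammer c i * pochhammer d (n - i)) / fact n
        = s ^ i * pochhammer c i / fact i * (s ^ (n - i) * pochhammer d (n - i) / fact (n - i))"
      by simp
  qed simp
  finally show "bser s (c + d) $ n = (bser s c * bser s d) $ n"
    by (simp add: fps_mult_nth bser_def atLeast0AtMost)
qed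

lemma bser_deriv: "(1 - fps_const s * fps_X) * fps_deriv (bser s c) = fps_const (s * c) * bser s c"
proof (rule fps_ext)
  fix n
  have *: "fps_deriv (bser s c) $ n = s * (c + of_nat n) * bser s c $ n" for n
    by (simp add: bser_def pochhammer_rec' del: of_nat_Suc)
  show "((1 - fps_const s * fps_X) * fps_deriv (bser s c)) $ n = (fps_const (s * c) * bser s c) $ n"
  proof (cases n)
    case 0
    then show ?thesis using *[of 0] by (simp add: left_diff_distrib)
  next
    case (Suc m)
    have "fps_deriv (bser s c) $ m = of_nat n * bser s c $ n" by (simp add: Suc)
    then show ?thesis using *[of n] Suc
      by (simp add: left_diff_distrib mult.assoc algebra_simps)
  qed
qed

text \<open>The product is \<open>(1 - X^2)\<close> to the power \<open>-c\<close>. Its differential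
  equation gives the two-step recurrence \<open>(n + 2) P (n + 2) = (n + 2 c) P n\<close>, started
  at 1 and 0.\<close>

lemma bser_opposite_mult_nonneg:
  assumes "0 \<le> c"
  shows "0 \<le> (bser 1 c * bser (- 1) c) $ n"
proof -
  define P where "P = bser 1 c * bser (- 1) c"
  have d1: "(1 - fps_X) * fps_deriv (bser 1 c) = fps_const c * bser 1 c"
    using bser_deriv[of 1 c] by simp
  have d2: "(1 + fps_X) * fps_deriv (bser (- 1) c) = - (fps_const c * bser (- 1) c)"
    using bser_deriv[of "- 1" c] by (simp flip: fps_const_neg)
  have C2: "fps_const (2 * c) = 2 * fps_const c" by (simp add: numeral_fps_const)
  have "(1 - fps_X ^ 2) * fps_deriv P
      = (1 + fps_X) * bser (- 1) c * ((1 - fps_X) * fps_deriv (bser 1 c))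
      + (1 - fps_X) * bser 1 c * ((1 + fps_X) * fps_deriv (bser (- 1) c))"
    by (simp add: P_def power2_eq_square algebra_simps)
  also have "\<dots> = 2 * fps_const c * fps_X * P"
    unfolding d1 d2 by (simp add: P_def algebra_simps)
  finally have ode: "fps_deriv P = fps_X * (fps_X * fps_deriv P + fps_const (2 * c) * P)"
    by (subst C2) (simp add: algebra_simps power2_eq_square)
  have P0: "P $ 0 = 1" by (simp add: P_def bser_def)
  have P1: "P $ 1 = 0" using arg_cong[OF ode, of "\<lambda>f. f $ 0"] by simp
  have rec: "real (Suc (Suc n)) * P $ Suc (Suc n) = (real n + 2 * c) * P $ n" for n
    using arg_cong[OF ode, of "\<lambda>f. f $ Suc n"] by (cases n) (simp_all add: algebra_simps)
  have "0 \<le> P $ n"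
  proof (induction n rule: induct_nat_012)
    case (ge2 n)
    then have "0 \<le> real (Suc (Suc n)) * P $ Suc (Suc n)" unfolding rec using assms by simp
    then show ?case by (simp add: zero_le_mult_iff)
  qed (use P0 P1 in auto)
  then show ?thesis by (simp add: P_def)
qed

lemma fps_mult_nonneg:
  fixes f g :: "real fps"
  assumes "\<And>n. 0 \<le> f $ n" "\<And>n. 0 \<le> g $ n"
  shows "0 \<le> (f * g) $ n"
  using assms by (auto simp: fps_mult_nth intro!: sum_nonneg)

text \<open>Even coefficients cancel and odd ones double.\<close>

lemma bser_diff_nonneg: "0 \<le> c \<Longrightarrow> 0 \<le> (bser 1 c - bser (- 1) c) $ n"
  by (cases "c = 0"; cases "even n") (auto simp: bser_def pochhammer_nonneg pochhammer_0_left)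

text \<open>\<open>c y i\<close> is the coefficient of \<open>X^(2 i)\<close> in
  \<open>bser 1 y\<close>, so \<open>E y\<close>, twice the even part, turns the sum into a
  coefficient of a Turanian that factors completely.\<close>

lemma even_turan_sum_nonpos:
  fixes x \<alpha> \<beta> :: real
  defines "c \<equiv> \<lambda>y i. pochhammer y (2 * i) / fact (2 * i)"
  assumes x: "0 < x" and ab: "0 \<le> \<alpha>" "0 \<le> \<beta>"
  shows "(\<Sum>i\<le>k. c (x + \<alpha>) i * c (x + \<beta>) (k - i) - c x i * c (x + \<alpha> + \<beta>) (k - i)) \<le> 0"
proof -
  define E where "E = (\<lambda>y. bser 1 y + bser (- 1) y)"
  have E: "E y $ (2 * i) = 2 * c y i" "odd n \<Longrightarrow> E y $ n = 0" for y i n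
    by (auto simp: E_def bser_def c_def)
  have EE: "(E y * E z) $ (2 * k) = (\<Sum>i\<le>k. 4 * (c y i * c z (k - i)))" for y z
    using E by (subst fps_even_mult_nth) (auto simp: mult_ac)
  \<comment> \<open>After \<open>bser_add\<close> the terms containing a square of
    \<open>bser 1 x\<close> or of \<open>bser (- 1) x\<close> cancel; only the mixed ones
    survive.\<close>
  have "E (x + \<alpha>) * E (x + \<beta>) - E x * E (x + \<alpha> + \<beta>)
      = - (bser 1 x * bser (- 1) x * ((bser 1 \<alpha> - bser (- 1) \<alpha>) * (bser 1 \<beta> - bser (- 1) \<beta>)))"
    by (simp add: E_def bser_add algebra_simps)
  moreover have "0 \<le> (bser 1 x * bser (- 1) x * ((bser 1 \<alpha> - bser (- 1) \<alpha>) * (bser 1 \<beta> - bser (- 1) \<beta>))) $ (2 * k)"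
    using x ab by (intro fps_mult_nonneg bser_opposite_mult_nonneg bser_diff_nonneg) auto
  ultimately have "(E (x + \<alpha>) * E (x + \<beta>) - E x * E (x + \<alpha> + \<beta>)) $ (2 * k) \<le> 0" by simp
  then show ?thesis by (simp add: EE sum_subtractf flip: sum_distrib_left)
qed

text \<open>Since \<open>pochhammer y (2 * i + 2)\<close> is \<open>y\<close> times
  \<open>pochhammer (y + 1) (2 * i + 1)\<close>, the \<open>c y i\<close> are the odd coefficients
  of \<open>y\<close> times \<open>bser 1 (y + 1)\<close>, and \<open>H y\<close> is twice its odd
  part.\<close>

lemma odd_turan_sum_nonneg:
  fixes x \<alpha> \<beta> :: real
  defines "c \<equiv> \<lambda>y i. pochhammer y (2 * i + 2) / fact (2 * i + 1)"
  assumes x: "0 < x" and ab: "0 \<le> \<alpha>" "0 \<le> \<beta>"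
  shows "0 \<le> (\<Sum>i\<le>k. c (x + \<alpha>) i * c (x + \<beta>) (k - i) - c x i * c (x + \<alpha> + \<beta>) (k - i))"
proof -
  define D where "D = (\<lambda>y. bser 1 y - bser (- 1) y)"
  define H where "H = (\<lambda>y. fps_const y * D (y + 1))"
  have H: "H y $ (2 * i + 1) = 2 * c y i" "even n \<Longrightarrow> H y $ n = 0" for y i n
    using pochhammer_rec[of y "2 * i + 1"]
    by (auto simp: H_def D_def bser_def c_def mult_ac)
  have HH: "(H y * H z) $ (2 * k + 2) = (\<Sum>i\<le>k. 4 * (c y i * c z (k - i)))" for y z
    using H by (subst fps_odd_mult_nth) (auto simp: mult_ac)
  define M N a b a' b' where "M = bser 1 (x + 1)" and "N = bser (- 1) (x + 1)"
    and "a = bser 1 \<alpha>" and "b = bser 1 \<beta>" and "a' = bser (- 1) \<alpha>" and "b' = bser (- 1) \<beta>"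
  have D: "D (x + 1) = M - N" "D (x + 1 + \<alpha>) = M * a - N * a'" "D (x + 1 + \<beta>) = M * b - N * b'"
    "D (x + 1 + \<alpha> + \<beta>) = M * a * b - N * a' * b'" "D \<alpha> = a - a'" "D \<beta> = b - b'"
    by (simp_all only: D_def bser_add M_def N_def a_def b_def a'_def b'_def)
  define A B X where "A = fps_const \<alpha>" and "B = fps_const \<beta>" and "X = fps_const x"
  have "H (x + \<alpha>) * H (x + \<beta>) - H x * H (x + \<alpha> + \<beta>)
      = (X + A) * (X + B) * (D (x + 1 + \<alpha>) * D (x + 1 + \<beta>))
        - X * (X + A + B) * (D (x + 1) * D (x + 1 + \<alpha> + \<beta>))"
    by (simp add: H_def A_def B_def X_def ac_simps flip: fps_const_add)
  \<comment> \<open>Uses \<open>(X + A) * (X + B) = X * (X + A + B) + A * B\<close>; the Turanian of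
    \<open>D\<close> factors as in the even case, now with a positive sign.\<close>
  also have "\<dots> = A * B * (D (x + 1 + \<alpha>) * D (x + 1 + \<beta>)) + X * (X + A + B) * (M * N * (D \<alpha> * D \<beta>))"
    unfolding D by algebra
  also have "\<dots> = fps_const (\<alpha> * \<beta>) * (D (x + 1 + \<alpha>) * D (x + 1 + \<beta>))
      + fps_const (x * (x + \<alpha> + \<beta>)) * (M * N * (D \<alpha> * D \<beta>))"
    by (simp add: A_def B_def X_def)
  finally have eq: "H (x + \<alpha>) * H (x + \<beta>) - H x * H (x + \<alpha> + \<beta>) = \<dots>" .
  have Dnn: "0 \<le> D y $ n" if "0 \<le> y" for y n
    using bser_diff_nonneg[OF that] by (simp add: D_def)
  have "0 \<le> (D (x + 1 + \<alpha>) * D (x + 1 + \<beta>)) $ (2 * k + 2)"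
    "0 \<le> (M * N * (D \<alpha> * D \<beta>)) $ (2 * k + 2)"
    unfolding M_def N_def
    using x ab by (intro fps_mult_nonneg bser_opposite_mult_nonneg Dnn; simp)+
  then have "0 \<le> (H (x + \<alpha>) * H (x + \<beta>) - H x * H (x + \<alpha> + \<beta>)) $ (2 * k + 2)"
    unfolding eq fps_add_nth fps_mult_left_const_nth using x ab
    by (intro add_nonneg_nonneg mult_nonneg_nonneg) auto
  then show ?thesis by (simp only: HH fps_sub_nth) (simp add: sum_subtractf flip: sum_distrib_left)
qed

subsection \<open>Monotone ratios of shifted products\<close>

text \<open>Increasing coefficient ratios \<open>B k / A k\<close> make the ratio of the polynomials
  increasing. The cross-multiplied hypothesis admits zero coefficients. Antisymmetrizing the double
  sum over \<open>k\<close> and \<open>l\<close> leaves products of two factors of equal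
  sign.\<close>

lemma poly_ratio_mono:
  fixes A B :: "nat \<Rightarrow> real"
  assumes AB: "\<And>k l. k < l \<Longrightarrow> l \<le> n \<Longrightarrow> B k * A l \<le> B l * A k" and xy: "0 \<le> x" "x \<le> y"
  shows "(\<Sum>k\<le>n. B k * x ^ k) * (\<Sum>k\<le>n. A k * y ^ k) \<le> (\<Sum>k\<le>n. B k * y ^ k) * (\<Sum>k\<le>n. A k * x ^ k)"
proof -
  define d where "d = (\<lambda>k l. y ^ k * x ^ l - x ^ k * y ^ l)"
  have d: "0 \<le> d k l" if "l \<le> k" for k l
  proof -
    have "x ^ l * (y ^ l * x ^ (k - l)) \<le> x ^ l * (y ^ l * y ^ (k - l))"
      using xy by (intro mult_left_mono power_mono) auto
    moreover have "y ^ k = y ^ l * y ^ (k - l)" "x ^ k = x ^ l * x ^ (k - l)"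
      using that by (simp_all flip: power_add)
    ultimately show ?thesis by (simp add: d_def mult_ac)
  qed
  have dd: "d k l = - d l k" for k l by (simp add: d_def mult_ac)
  have nonneg: "0 \<le> (B k * A l - B l * A k) * d k l" if "k \<le> n" "l \<le> n" for k l
  proof (cases k l rule: linorder_cases)
    case less
    then show ?thesis using AB[of k l] d[of k l] d[of l k] dd[of k l] that
      by (intro mult_nonpos_nonpos) auto
  next
    case greater
    then show ?thesis using AB[of l k] d[of l k] that by (intro mult_nonneg_nonneg d) auto
  qed simp
  have "(\<Sum>k\<le>n. \<Sum>l\<le>n. B l * A k * d k l) = (\<Sum>k\<le>n. \<Sum>l\<le>n. B k * A l * d l k)"
    by (rule sum.swap)
  also have "\<dots> = - (\<Sum>k\<le>n. \<Sum>l\<le>n. B k * A l * d k l)"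
    by (subst dd) (simp add: sum_negf)
  finally have "2 * (\<Sum>k\<le>n. \<Sum>l\<le>n. B k * A l * d k l)
      = (\<Sum>k\<le>n. \<Sum>l\<le>n. (B k * A l - B l * A k) * d k l)"
    by (simp add: left_diff_distrib sum_subtractf)
  also have "0 \<le> \<dots>" by (intro sum_nonneg nonneg) auto
  finally have "0 \<le> (\<Sum>k\<le>n. \<Sum>l\<le>n. B k * A l * d k l)" by simp
  also have "\<dots> = (\<Sum>k\<le>n. B k * y ^ k) * (\<Sum>k\<le>n. A k * x ^ k)
      - (\<Sum>k\<le>n. B k * x ^ k) * (\<Sum>k\<le>n. A k * y ^ k)"
    unfolding sum_product sum_subtractf[symmetric]
    by (intro sum.cong) (auto simp: d_def algebra_simps)
  finally show ?thesis by simp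
qed

lemma prod_shift_eq_esym_sum:
  "(\<Prod>i<length xs. xs ! i + x) = (\<Sum>k\<le>length xs. esym (length xs - k) xs * x ^ k)"
proof -
  let ?n = "length xs"
  let ?h = "\<lambda>X. (\<Prod>i\<in>X. xs ! i) * x ^ (?n - card X)"
  have "(\<Prod>i<?n. xs ! i + x) = (\<Sum>X\<in>Pow {..<?n}. (\<Prod>i\<in>X. xs ! i) * (\<Prod>i\<in>{..<?n} - X. x))"
    by (rule prod_add) simp
  also have "\<dots> = (\<Sum>X\<in>Pow {..<?n}. ?h X)"
    by (intro sum.cong) (auto simp: card_Diff_subset finite_subset)
  also have "\<dots> = (\<Sum>k\<le>?n. \<Sum>X\<in>{X \<in> Pow {..<?n}. ?n - card X = k}. ?h X)"
    by (rule sum.group[symmetric]) auto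
  also have "\<dots> = (\<Sum>k\<le>?n. esym (?n - k) xs * x ^ k)"
  proof (rule sum.cong)
    fix k assume k: "k \<in> {..?n}"
    have "card X \<le> ?n" if "X \<subseteq> {..<?n}" for X using card_mono[OF _ that] by simp
    then have "{X \<in> Pow {..<?n}. ?n - card X = k} = {X. X \<subseteq> {..<?n} \<and> card X = ?n - k}"
      using k by fastforce
    then show "(\<Sum>X\<in>{X \<in> Pow {..<?n}. ?n - card X = k}. ?h X) = esym (?n - k) xs * x ^ k"
      using k by (simp add: esym_def sum_distrib_right)
  qed simp
  finally show ?thesis .
qed

lemma esym_nonneg:
  assumes "\<And>x. x \<in> set xs \<Longrightarrow> 0 < x"
  shows "0 \<le> esym k xs"
  unfolding esym_def using assms by (intro sum_nonneg prod_nonneg) (auto intro!: less_imp_le nth_mem)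

lemma esym_pos:
  assumes "\<And>x. x \<in> set xs \<Longrightarrow> 0 < x" "k \<le> length xs"
  shows "0 < esym k xs"
  unfolding esym_def
proof (rule sum_pos)
  have "finite (Pow {..<length xs})" by simp
  then show "finite {I. I \<subseteq> {..<length xs} \<and> card I = k}" by (rule rev_finite_subset) auto
  have "{..<k} \<subseteq> {..<length xs}" "card {..<k} = k" using assms(2) by auto
  then show "{I. I \<subseteq> {..<length xs} \<and> card I = k} \<noteq> {}" by blast
qed (use assms(1) in \<open>auto intro!: prod_pos nth_mem\<close>)

text \<open>Condition (S) says that the ratios of the coefficients of \<open>x^k\<close> in the two
  shifted products increase for \<open>k \<le> p\<close>.\<close>

lemma cond_S_ratio_mono:
  assumes len: "length a \<le> length b" and S: "cond_S a b"
    and pos: "\<And>u. u \<in> set a \<Longrightarrow> 0 < u" "\<And>u. u \<in> set b \<Longrightarrow> 0 < u"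
    and xy: "0 \<le> x" "x \<le> y"
  shows "(\<Prod>i<length b. b ! i + x) * (\<Prod>i<length a. a ! i + y)
       \<le> (\<Prod>i<length b. b ! i + y) * (\<Prod>i<length a. a ! i + x)"
proof -
  define p q where "p = length a" and "q = length b"
  \<comment> \<open>Padding by 0 is essential: for \<open>k > p\<close> the truncated
    \<open>p - k\<close> is 0, and \<open>esym 0 a\<close> would be 1.\<close>
  define A where "A = (\<lambda>k. if k \<le> p then esym (p - k) a else 0)"
  define B where "B = (\<lambda>k. esym (q - k) b)"
  have A: "(\<Prod>i<length a. a ! i + t) = (\<Sum>k\<le>q. A k * t ^ k)" for t
    unfolding prod_shift_eq_esym_sum
    by (rule sum.mono_neutral_cong_left) (use len in \<open>auto simp: A_def p_def q_def\<close>)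
  have B: "(\<Prod>i<length b. b ! i + t) = (\<Sum>k\<le>q. B k * t ^ k)" for t
    by (simp add: prod_shift_eq_esym_sum B_def q_def)
  have Apos: "0 < A k" if "k \<le> p" for k
    using that esym_pos[of a] pos(1) by (auto simp: A_def p_def)
  have B0: "0 \<le> B k" for k using esym_nonneg[of b] pos(2) by (auto simp: B_def)
  have chain: "B k / A k \<le> B l / A l" if "k \<le> l" "l \<le> p" for k l
    using that
  proof (induction l rule: dec_induct)
    case (step l)
    then have "B l / A l \<le> B (Suc l) / A (Suc l)"
      using S by (auto simp: cond_S_def Let_def A_def B_def p_def q_def)
    with step show ?case by simp
  qed simp
  show ?thesis
    unfolding A B
  proof (rule poly_ratio_mono[OF _ xy])
    fix k l assume kl: "k < l" "l \<le> q"
    show "B k * A l \<le> B l * A k"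
    proof (cases "l \<le> p")
      case True
      then show ?thesis using chain[of k l] Apos[of k] Apos[of l] kl by (simp add: field_simps)
    next
      case False
      have "0 \<le> A k" using Apos[of k] by (cases "k \<le> p") (auto simp: A_def)
      with False show ?thesis using B0[of l] by (simp add: A_def)
    qed
  qed
qed

section \<open>Condition (M) and weak supermajorization\<close>

text \<open>Abel summation as an induction: the bound \<open>w m\<close> times the partial sum of
  \<open>d\<close> persists because that partial sum is nonnegative and \<open>w\<close>
  decreases.\<close>

lemma sum_antimono_weights_nonneg:
  fixes w d :: "nat \<Rightarrow> real"
  assumes w: "\<And>i j. i \<le> j \<Longrightarrow> j < n \<Longrightarrow> w j \<le> w i" "\<And>i. i < n \<Longrightarrow> 0 \<le> w i"
    and d: "\<And>k. 1 \<le> k \<Longrightarrow> k \<le> n \<Longrightarrow> 0 \<le> (\<Sum>j<k. d j)"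
  shows "0 \<le> (\<Sum>j<n. w j * d j)"
proof -
  have *: "w m * (\<Sum>j<Suc m. d j) \<le> (\<Sum>j<Suc m. w j * d j)" if "m < n" for m
    using that
  proof (induction m)
    case (Suc m)
    have "w (Suc m) * (\<Sum>j<Suc m. d j) \<le> w m * (\<Sum>j<Suc m. d j)"
      using Suc.prems by (intro mult_right_mono w d) auto
    also have "\<dots> \<le> (\<Sum>j<Suc m. w j * d j)" using Suc by simp
    finally show ?case by (simp add: distrib_left)
  qed simp
  show ?thesis
  proof (cases n)
    case (Suc m)
    have "0 \<le> w m * (\<Sum>j<Suc m. d j)" using Suc by (intro mult_nonneg_nonneg w d) auto
    with *[of m] Suc show ?thesis by simp
  qed simp
qed

text \<open>
  Weak supermajorization applied to the decreasing convex function
  \<open>t \<mapsto> ln ((t + y) / (t + x))\<close>, in the form of its tangent inequalities at the \<open>u j\<close>.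
\<close>

lemma supermajorization_prod_ratio:
  fixes u v :: "nat \<Rightarrow> real"
  assumes u: "\<And>i j. i \<le> j \<Longrightarrow> j < n \<Longrightarrow> u i \<le> u j"
    and pos: "\<And>i. i < n \<Longrightarrow> 0 < u i" "\<And>i. i < n \<Longrightarrow> 0 < v i"
    and maj: "\<And>k. 1 \<le> k \<Longrightarrow> k \<le> n \<Longrightarrow> (\<Sum>j<k. v j) \<le> (\<Sum>j<k. u j)"
    and xy: "0 \<le> x" "x \<le> y"
  shows "(\<Prod>i<n. v i + x) * (\<Prod>i<n. u i + y) \<le> (\<Prod>i<n. v i + y) * (\<Prod>i<n. u i + x)"
proof -
  \<comment> \<open>\<open>w j\<close> is minus the derivative of
    \<open>ln ((t + y) / (t + x))\<close> at \<open>t = u j\<close>; \<open>z j\<close> is the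
    quotient of \<open>(t + y) / (t + x)\<close> at \<open>v j\<close> by its value at
    \<open>u j\<close>.\<close>
  define w where "w = (\<lambda>j. (y - x) / ((u j + x) * (u j + y)))"
  define z where "z = (\<lambda>j. ((v j + y) * (u j + x)) / ((v j + x) * (u j + y)))"
  have p: "0 < u j + x" "0 < u j + y" "0 < v j + x" "0 < v j + y" if "j < n" for j
    using pos[OF that] xy by auto
  have zpos: "0 < z j" if "j < n" for j using p[OF that] by (simp add: z_def)
  \<comment> \<open>From \<open>ln z \<ge> 1 - 1 / z\<close>, where \<open>1 - 1 / z j\<close> is
    \<open>w j * (u j - v j)\<close> with \<open>u j + y\<close> replaced by \<open>v j + y\<close>
    in the denominator; the square of \<open>u j - v j\<close> gives the direction of that
    replacement.\<close>
  have tangent: "w j * (u j - v j) \<le> ln (z j)" if "j < n" for j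
  proof -
    note pj = p[OF that]
    have "(u j - v j) * (u j + y) - (u j - v j) * (v j + y) = (u j - v j)\<^sup>2"
      by (simp add: power2_eq_square algebra_simps)
    then have "(u j - v j) * (v j + y) \<le> (u j - v j) * (u j + y)"
      using zero_le_power2[of "u j - v j"] by linarith
    then have "(u j - v j) / (u j + y) \<le> (u j - v j) / (v j + y)"
      using pj by (simp add: field_simps)
    then have "(y - x) / (u j + x) * ((u j - v j) / (u j + y)) \<le> (y - x) / (u j + x) * ((u j - v j) / (v j + y))"
      using pj xy by (intro mult_left_mono) auto
    also have "\<dots> = ((y - x) * (u j - v j)) / ((v j + y) * (u j + x))"
      by (simp only: times_divide_times_eq mult.commute)
    also have "(y - x) * (u j - v j) = (v j + y) * (u j + x) - (v j + x) * (u j + y)"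
      by (simp add: algebra_simps)
    also have "\<dots> / ((v j + y) * (u j + x)) = 1 - 1 / z j"
      using pj by (simp add: z_def diff_divide_distrib)
    also have "\<dots> \<le> ln (z j)"
      using ln_le_minus_one[of "1 / z j"] zpos[OF that] by (simp add: ln_div)
    finally show ?thesis by (simp add: w_def)
  qed
  have "0 \<le> (\<Sum>j<n. w j * (u j - v j))"
  proof (rule sum_antimono_weights_nonneg)
    fix i j assume "i \<le> j" "j < n"
    then show "w j \<le> w i"
      unfolding w_def using p[of i] p[of j] u[of i j] xy by (intro divide_left_mono mult_mono) auto
  qed (use p xy maj in \<open>auto simp: w_def sum_subtractf less_imp_le\<close>)
  also have "\<dots> \<le> (\<Sum>j<n. ln (z j))" by (intro sum_mono tangent) auto
  finally have "1 \<le> exp (\<Sum>j<n. ln (z j))" by simp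
  also have "\<dots> = (\<Prod>j<n. z j)" by (simp add: exp_sum zpos)
  also have "\<dots> = ((\<Prod>i<n. v i + y) * (\<Prod>i<n. u i + x)) / ((\<Prod>i<n. v i + x) * (\<Prod>i<n. u i + y))"
    by (simp add: z_def prod.distrib prod_dividef)
  finally show ?thesis
    using p by (subst (asm) le_divide_eq_1_pos) (auto intro!: mult_pos_pos prod_pos)
qed

lemma prod_nth_sort:
  fixes f :: "'a::linorder \<Rightarrow> 'b::comm_monoid_mult"
  shows "(\<Prod>i<length xs. f (sort xs ! i)) = (\<Prod>i<length xs. f (xs ! i))"
proof -
  have *: "(\<Prod>i<length ys. f (ys ! i)) = prod_mset (mset (map f ys))" for ys
    unfolding prod_mset_prod_list by (simp add: prod.list_conv_set_nth atLeast0LessThan)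
  show ?thesis using *[of "sort xs"] *[of xs] by simp
qed

text \<open>The selected entries of \<open>b\<close> are compared with \<open>sort a\<close>, whose
  product is that of \<open>a\<close>; the remaining factors \<open>R\<close> increase with the
  shift.\<close>

lemma cond_M_ratio_mono:
  assumes M: "cond_M a b"
    and pos: "\<And>u. u \<in> set a \<Longrightarrow> 0 < u" "\<And>u. u \<in> set b \<Longrightarrow> 0 < u"
    and xy: "0 \<le> x" "x \<le> y"
  shows "(\<Prod>i<length b. b ! i + x) * (\<Prod>i<length a. a ! i + y)
       \<le> (\<Prod>i<length b. b ! i + y) * (\<Prod>i<length a. a ! i + x)"
proof -
  obtain ns where ns: "length ns = length a" "distinct ns" "set ns \<subseteq> {..<length b}"
    and maj: "\<And>k. 1 \<le> k \<Longrightarrow> k \<le> length a \<Longrightarrow> (\<Sum>j<k. b ! (ns ! j)) \<le> (\<Sum>j<k. sort a ! j)"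
    using M by (auto simp: cond_M_def)
  define R where "R = (\<lambda>t. \<Prod>i\<in>{..<length b} - set ns. b ! i + t)"
  have B: "(\<Prod>i<length b. b ! i + t) = R t * (\<Prod>j<length a. b ! (ns ! j) + t)" for t
  proof -
    have "(\<Prod>i\<in>set ns. b ! i + t) = (\<Prod>j<length a. b ! (ns ! j) + t)"
      using prod.reindex_bij_betw[OF bij_betw_nth[OF ns(2) refl refl], of "\<lambda>i. b ! i + t"] ns(1)
      by simp
    then show ?thesis
      using prod.subset_diff[OF ns(3), of "\<lambda>i. b ! i + t"] by (simp add: R_def)
  qed
  have "(\<Prod>j<length a. b ! (ns ! j) + x) * (\<Prod>j<length a. sort a ! j + y)
      \<le> (\<Prod>j<length a. b ! (ns ! j) + y) * (\<Prod>j<length a. sort a ! j + x)"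
  proof (rule supermajorization_prod_ratio[OF _ _ _ maj xy])
    fix i assume "i < length a"
    then have "sort a ! i \<in> set a" "ns ! i < length b"
      using nth_mem[of i "sort a"] nth_mem[of i ns] ns by (auto simp: subset_iff)
    then show "0 < sort a ! i" "0 < b ! (ns ! i)" using pos by auto
  qed (auto intro: sorted_nth_mono)
  then have main: "(\<Prod>j<length a. b ! (ns ! j) + x) * (\<Prod>j<length a. a ! j + y)
      \<le> (\<Prod>j<length a. b ! (ns ! j) + y) * (\<Prod>j<length a. a ! j + x)"
    using prod_nth_sort[of "\<lambda>u. u + x" a] prod_nth_sort[of "\<lambda>u. u + y" a] by simp
  have b0: "0 < b ! i" if "i < length b" for i using pos(2) that by simp
  have a0: "0 < a ! i" if "i < length a" for i using pos(1) that by simp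
  have bn0: "0 < b ! (ns ! i)" if "i < length a" for i
    using b0[of "ns ! i"] nth_mem[of i ns] ns that by (auto simp: subset_iff)
  have R: "R x \<le> R y" "0 \<le> R y"
    unfolding R_def using b0 xy by (auto intro!: prod_mono prod_nonneg simp: less_imp_le)
  have "R x * ((\<Prod>j<length a. b ! (ns ! j) + x) * (\<Prod>j<length a. a ! j + y))
      \<le> R y * ((\<Prod>j<length a. b ! (ns ! j) + y) * (\<Prod>j<length a. a ! j + x))"
    by (rule mult_mono[OF R(1) main R(2)])
      (use a0 bn0 xy in \<open>auto intro!: mult_nonneg_nonneg prod_nonneg add_nonneg_nonneg simp: less_imp_le\<close>)
  then show ?thesis by (simp add: B mult_ac)
qed

subsection \<open>Weighted sums\<close>

text \<open>Applies \<open>single_crossing_weights\<close> to the symmetrized terms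
  \<open>T\<close>, whose signs are those of \<open>P\<close> because the denominators are positive.
  The shift \<open>s\<close> is 0 for the even series and 2 for the odd one.\<close>

lemma turan_weighted_sum:
  fixes x \<alpha> \<beta> :: real and w G :: "nat \<Rightarrow> real" and s :: nat
  defines "c \<equiv> \<lambda>y i. pochhammer y (2 * i + s) / w i"
  defines "D \<equiv> \<lambda>i k. c (x + \<alpha>) i * c (x + \<beta>) (k - i) - c x i * c (x + \<alpha> + \<beta>) (k - i)"
  assumes w: "\<And>i. 0 < w i" and x: "0 < x" and ab: "0 \<le> \<alpha>" "0 \<le> \<beta>"
    and Gsym: "\<And>i. i \<le> k \<Longrightarrow> G (k - i) = G i" and G: "\<And>i. 2 * i + 1 < k \<Longrightarrow> G i \<le> G (Suc i)"
  shows "\<exists>j\<le>k. G j * (\<Sum>i\<le>k. D i k) \<le> (\<Sum>i\<le>k. G i * D i k)"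
proof -
  define T where "T = (\<lambda>i. D i k + D (k - i) k)"
  define P where "P = (\<lambda>n m. pochhammer (x + \<alpha>) n * pochhammer (x + \<beta>) m
                + pochhammer (x + \<alpha>) m * pochhammer (x + \<beta>) n
                - pochhammer x n * pochhammer (x + \<alpha> + \<beta>) m
                - pochhammer x m * pochhammer (x + \<alpha> + \<beta>) n)"
  have P: "P n (Suc m) \<le> 0" if "n < m" "P (Suc n) m \<le> 0" for n m
    using pochhammer_turan_step[OF x ab that(1)] that(2) by (simp add: P_def)
  have T: "T i = P (2 * i + s) (2 * (k - i) + s) / (w i * w (k - i))" if "i \<le> k" for i
    using that by (simp add: T_def D_def c_def P_def diff_divide_distrib add_divide_distrib mult_ac)
  have "\<exists>j\<le>k. G j * (\<Sum>i\<le>k. T i) \<le> (\<Sum>i\<le>k. G i * T i)"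
  proof (rule single_crossing_weights[OF Gsym _ G])
    show "T (k - i) = T i" if "i \<le> k" for i using that by (simp add: T_def)
    fix i assume i: "2 * i + 1 < k" and "T (Suc i) \<le> 0"
    define m where "m = 2 * (k - Suc i) + s"
    have "0 < w (Suc i) * w (k - Suc i)" using w by simp
    with \<open>T (Suc i) \<le> 0\<close> have "P (Suc (Suc (2 * i + s))) m \<le> 0"
      using i by (simp add: T m_def divide_le_0_iff not_le)
    \<comment> \<open>Lowering \<open>i\<close> by one moves both lengths by two, so the one-step
      sign rule is used twice.\<close>
    then have "P (2 * i + s) (Suc (Suc m)) \<le> 0"
      using i by (intro P) (auto simp: m_def)
    moreover have "Suc (Suc m) = 2 * (k - i) + s" using i by (simp add: m_def)
    ultimately show "T i \<le> 0"
      using w[of i] w[of "k - i"] i by (simp add: T divide_le_0_iff)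
  qed
  moreover have refl: "(\<Sum>i\<le>k. f (k - i)) = (\<Sum>i\<le>k. f i)" for f :: "nat \<Rightarrow> real"
    by (rule sum.nat_diff_reindex[of _ "Suc k", simplified lessThan_Suc_atMost, simplified])
  have "(\<Sum>i\<le>k. T i) = 2 * (\<Sum>i\<le>k. D i k)"
    using refl[of "\<lambda>i. D i k"] by (simp add: T_def sum.distrib)
  moreover have "(\<Sum>i\<le>k. G i * T i) = 2 * (\<Sum>i\<le>k. G i * D i k)"
  proof -
    have "(\<Sum>i\<le>k. G i * D (k - i) k) = (\<Sum>i\<le>k. G (k - i) * D (k - i) k)"
      by (intro sum.cong) (auto simp: Gsym)
    then show ?thesis
      using refl[of "\<lambda>i. G i * D i k"] by (simp add: T_def distrib_left sum.distrib)
  qed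
  ultimately show ?thesis by auto
qed

lemma gen_Turanian_nth:
  assumes "\<And>y i. f y $ i = r i * c y i"
  shows "gen_Turanian f x \<alpha> \<beta> $ k
    = (\<Sum>i\<le>k. r i * r (k - i) * (c (x + \<alpha>) i * c (x + \<beta>) (k - i) - c x i * c (x + \<alpha> + \<beta>) (k - i)))"
  by (simp add: gen_Turanian_def fps_mult_nth assms atLeast0AtMost right_diff_distrib
      sum_subtractf mult_ac)

text \<open>The two sides differ by the factors \<open>\<rho> (k - Suc i)\<close> and
  \<open>\<rho> i\<close>, and \<open>2 * i + 1 < k\<close> gives
  \<open>i \<le> k - Suc i\<close>.\<close>

lemma log_concave_prod_le:
  fixes r :: "nat \<Rightarrow> real"
  assumes r: "\<And>n. 0 < r n" "\<And>n. r (Suc n) = r n * \<rho> n"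
    and \<rho>: "\<And>m n. m \<le> n \<Longrightarrow> \<rho> n \<le> \<rho> m" and "2 * i + 1 < k"
  shows "r i * r (k - i) \<le> r (Suc i) * r (k - Suc i)"
proof -
  have "k - i = Suc (k - Suc i)" using assms(4) by simp
  then have "r i * r (k - i) = r i * r (k - Suc i) * \<rho> (k - Suc i)" using r(2) by simp
  also have "\<dots> \<le> r i * r (k - Suc i) * \<rho> i"
    using r(1) assms(4) by (intro mult_left_mono \<rho> mult_nonneg_nonneg less_imp_le) auto
  finally show ?thesis by (simp add: r(2) mult_ac)
qed

lemma log_convex_prod_le:
  fixes r :: "nat \<Rightarrow> real"
  assumes r: "\<And>n. 0 < r n" "\<And>n. r (Suc n) = r n * \<rho> n"
    and \<rho>: "\<And>m n. m \<le> n \<Longrightarrow> \<rho> m \<le> \<rho> n" and "2 * i + 1 < k"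
  shows "r (Suc i) * r (k - Suc i) \<le> r i * r (k - i)"
proof -
  have "k - i = Suc (k - Suc i)" using assms(4) by simp
  have "r i * r (k - Suc i) * \<rho> i \<le> r i * r (k - Suc i) * \<rho> (k - Suc i)"
    using r(1) assms(4) by (intro mult_left_mono \<rho> mult_nonneg_nonneg less_imp_le) auto
  also have "\<dots> = r i * r (k - i)" unfolding \<open>k - i = _\<close> r(2) by simp
  finally show ?thesis by (simp add: r(2) mult_ac)
qed

text \<open>For log-convex \<open>r\<close> the products decrease towards the middle, so the weights
  \<open>G\<close> carry a minus sign; \<open>G j\<close> and the unweighted sum are then both
  nonpositive.\<close>

lemma even_turan_nonpos:
  assumes f: "\<And>y i. f y $ i = r i * (pochhammer y (2 * i) / fact (2 * i))"
    and r: "\<And>n. 0 < r n" "\<And>n. r (Suc n) = r n * \<rho> n"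
    and \<rho>: "\<And>m n. m \<le> n \<Longrightarrow> \<rho> m \<le> \<rho> n" and x: "0 < x" and ab: "0 \<le> \<alpha>" "0 \<le> \<beta>"
  shows "gen_Turanian f x \<alpha> \<beta> $ k \<le> 0"
proof -
  define G where "G = (\<lambda>i. - (r i * r (k - i)))"
  \<comment> \<open>The summand 0 matches the shift \<open>s\<close> in
    \<open>turan_weighted_sum\<close>.\<close>
  define c where "c = (\<lambda>y i. pochhammer y (2 * i + 0) / fact (2 * i) :: real)"
  define D where "D = (\<lambda>i. c (x + \<alpha>) i * c (x + \<beta>) (k - i) - c x i * c (x + \<alpha> + \<beta>) (k - i))"
  have "\<exists>j\<le>k. G j * (\<Sum>i\<le>k. D i) \<le> (\<Sum>i\<le>k. G i * D i)"
    unfolding D_def c_def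
  proof (rule turan_weighted_sum[OF _ x ab])
    show "G (k - i) = G i" if "i \<le> k" for i using that by (simp add: G_def)
    show "G i \<le> G (Suc i)" if "2 * i + 1 < k" for i
      using log_convex_prod_le[of r \<rho> i k, OF r \<rho> that] by (simp add: G_def)
  qed simp
  then obtain j where "G j * (\<Sum>i\<le>k. D i) \<le> (\<Sum>i\<le>k. G i * D i)" by blast
  moreover have "G j \<le> 0" using r(1) by (simp add: G_def less_imp_le)
  moreover have "(\<Sum>i\<le>k. D i) \<le> 0"
    using even_turan_sum_nonpos[OF x ab] by (simp add: D_def c_def)
  ultimately have "0 \<le> (\<Sum>i\<le>k. G i * D i)"
    by (meson mult_nonpos_nonpos order_trans)
  moreover have "gen_Turanian f x \<alpha> \<beta> $ k = - (\<Sum>i\<le>k. G i * D i)"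
    unfolding D_def G_def mult_minus_left sum_negf minus_minus
    by (rule gen_Turanian_nth) (simp add: f c_def)
  ultimately show ?thesis by simp
qed

lemma odd_turan_nonneg:
  assumes f: "\<And>y i. f y $ i = r i * (pochhammer y (2 * i + 2) / fact (2 * i + 1))"
    and r: "\<And>n. 0 < r n" "\<And>n. r (Suc n) = r n * \<rho> n"
    and \<rho>: "\<And>m n. m \<le> n \<Longrightarrow> \<rho> n \<le> \<rho> m" and x: "0 < x" and ab: "0 \<le> \<alpha>" "0 \<le> \<beta>"
  shows "0 \<le> gen_Turanian f x \<alpha> \<beta> $ k"
proof -
  define G where "G = (\<lambda>i. r i * r (k - i))"
  define c where "c = (\<lambda>y i. pochhammer y (2 * i + 2) / fact (2 * i + 1) :: real)"
  define D where "D = (\<lambda>i. c (x + \<alpha>) i * c (x + \<beta>) (k - i) - c x i * c (x + \<alpha> + \<beta>) (k - i))"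
  have "\<exists>j\<le>k. G j * (\<Sum>i\<le>k. D i) \<le> (\<Sum>i\<le>k. G i * D i)"
    unfolding D_def c_def
  proof (rule turan_weighted_sum[OF _ x ab])
    show "G (k - i) = G i" if "i \<le> k" for i using that by (simp add: G_def)
    show "G i \<le> G (Suc i)" if "2 * i + 1 < k" for i
      using log_concave_prod_le[of r \<rho> i k, OF r \<rho> that] by (simp add: G_def)
  qed simp
  then obtain j where "G j * (\<Sum>i\<le>k. D i) \<le> (\<Sum>i\<le>k. G i * D i)" by blast
  moreover have "0 \<le> G j" using r(1) by (simp add: G_def less_imp_le)
  moreover have "0 \<le> (\<Sum>i\<le>k. D i)"
    unfolding D_def c_def by (rule odd_turan_sum_nonneg[OF x ab])
  ultimately have "0 \<le> (\<Sum>i\<le>k. G i * D i)"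
    by (meson mult_nonneg_nonneg order_trans)
  also have "\<dots> = gen_Turanian f x \<alpha> \<beta> $ k"
    unfolding D_def G_def by (rule gen_Turanian_nth[symmetric]) (simp add: f c_def)
  finally show ?thesis .
qed

section \<open>Coefficients of the two hypergeometric series\<close>

lemma foldl_mult_eq_prod_nth:
  fixes v :: "'b::comm_monoid_mult"
  shows "foldl (\<lambda>r u. r * f u) v xs = v * (\<Prod>i<length xs. f (xs ! i))"
proof (induction xs arbitrary: v)
  case (Cons u xs)
  then show ?case by (simp add: prod.lessThan_Suc_shift mult.assoc del: prod.lessThan_Suc)
qed simp

text \<open>Duplication of both \<open>pochhammer y (2 * n)\<close> and \<open>fact (2 * n)\<close>;
  the powers of 4 cancel.\<close>

lemma hypergeo_even_nth:
  "fps_hypergeo ([y / 2, y / 2 + 1 / 2] @ b) ([1 / 2] @ a) 1 $ n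
    = (\<Prod>i<length b. pochhammer (b ! i) n) / (\<Prod>i<length a. pochhammer (a ! i) n)
      * (pochhammer y (2 * n) / fact (2 * n) :: real)"
  unfolding fact_double using pochhammer_double[of "y / 2" n]
  by (simp add: foldl_mult_eq_prod_nth prod.lessThan_Suc_shift mult_ac del: prod.lessThan_Suc)

text \<open>Here duplication is applied after splitting off \<open>pochhammer y 2\<close>, and to
  \<open>fact (2 * n + 1)\<close> written as \<open>pochhammer 2 (2 * n)\<close>.\<close>

lemma hypergeo_odd_nth:
  "(fps_const (pochhammer y 2) * fps_hypergeo ([y / 2 + 1, y / 2 + 3 / 2] @ a) ([3 / 2] @ b) 1) $ n
    = (\<Prod>i<length a. pochhammer (a ! i) n) / (\<Prod>i<length b. pochhammer (b ! i) n)
      * (pochhammer y (2 * n + 2) / fact (2 * n + 1) :: real)"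
proof -
  have "pochhammer y (2 * n + 2) = pochhammer y 2 * pochhammer (y + 2) (2 * n)"
    using pochhammer_product'[of y 2 "2 * n"] by (simp add: add.commute)
  also have "pochhammer (y + 2) (2 * n) = 2 ^ (2 * n) * pochhammer (y / 2 + 1) n * pochhammer (y / 2 + 3 / 2) n"
    using pochhammer_double[of "y / 2 + 1" n] by (simp add: algebra_simps)
  finally have 1: "pochhammer y (2 * n + 2)
      = pochhammer y 2 * (2 ^ (2 * n) * pochhammer (y / 2 + 1) n * pochhammer (y / 2 + 3 / 2) n)" .
  have "(fact (2 * n + 1) :: real) = pochhammer 2 (2 * n)"
    unfolding pochhammer_fact using pochhammer_rec[of "1 :: real" "2 * n"] by simp
  also have "\<dots> = 2 ^ (2 * n) * fact n * pochhammer (3 / 2) n"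
    using pochhammer_double[of "1 :: real" n] by (simp add: pochhammer_fact)
  finally have 2: "(fact (2 * n + 1) :: real) = 2 ^ (2 * n) * fact n * pochhammer (3 / 2) n" .
  show ?thesis
    unfolding 1 2 by (simp add: foldl_mult_eq_prod_nth prod.lessThan_Suc_shift mult_ac del: prod.lessThan_Suc)
qed

theorem theorem6p3:
  fixes p q :: nat and a b :: "real list"
  assumes "p \<le> q"
    and "length a = p" and "length b = q"
    and "\<forall>x\<in>set a. x > 0" and "\<forall>x\<in>set b. x > 0"
    and "cond_S a b \<or> cond_M a b"
  shows "(p = q \<longrightarrow>
            coeffwise_log_convex
              (\<lambda>\<mu>. fps_hypergeo ([\<mu> / 2, \<mu> / 2 + 1 / 2] @ b) ([1 / 2] @ a) 1)) \<and>
         coeffwise_log_concave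
           (\<lambda>\<mu>. fps_const (pochhammer \<mu> 2) *
                fps_hypergeo ([\<mu> / 2 + 1, \<mu> / 2 + 3 / 2] @ a) ([3 / 2] @ b) 1)"
proof -
  define A where "A = (\<lambda>t. \<Prod>i<length a. a ! i + t)"
  define B where "B = (\<lambda>t. \<Prod>i<length b. b ! i + t)"
  define PA where "PA = (\<lambda>n. \<Prod>i<length a. pochhammer (a ! i) n)"
  define PB where "PB = (\<lambda>n. \<Prod>i<length b. pochhammer (b ! i) n)"
  have AB: "B t * A u \<le> B u * A t" if "0 \<le> t" "t \<le> u" for t u
    using assms cond_S_ratio_mono[of a b t u] cond_M_ratio_mono[of a b t u] that
    by (auto simp: A_def B_def)
  have pos: "0 < A t" "0 < B t" if "0 \<le> t" for t
    unfolding A_def B_def using assms(4,5) that by (auto intro!: prod_pos add_pos_nonneg)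
  have Ppos: "0 < PA n" "0 < PB n" for n
    unfolding PA_def PB_def using assms(4,5) by (auto intro!: prod_pos pochhammer_pos)
  \<comment> \<open>Hence \<open>PB / PA\<close> has the consecutive quotients
    \<open>B n / A n\<close>, which increase by \<open>AB\<close>; for \<open>PA / PB\<close> they
    are the reciprocals.\<close>
  have PSuc: "PA (Suc n) = PA n * A (real n)" "PB (Suc n) = PB n * B (real n)" for n
    by (simp_all add: PA_def PB_def A_def B_def pochhammer_rec' prod.distrib mult.commute)
  have convex: "fps_nth (gen_Turanian (\<lambda>\<mu>. fps_hypergeo ([\<mu> / 2, \<mu> / 2 + 1 / 2] @ b) ([1 / 2] @ a) 1) x \<alpha> \<beta>) k \<le> 0"
    if "0 < x" "0 \<le> \<alpha>" "0 \<le> \<beta>" for x \<alpha> \<beta> :: real and k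
  proof (rule even_turan_nonpos[OF _ _ _ _ that])
    show "fps_hypergeo ([y / 2, y / 2 + 1 / 2] @ b) ([1 / 2] @ a) 1 $ i
        = PB i / PA i * (pochhammer y (2 * i) / fact (2 * i))" for y :: real and i
      unfolding PA_def PB_def by (rule hypergeo_even_nth)
    show "B (real m) / A (real m) \<le> B (real n) / A (real n)" if "m \<le> n" for m n
      using AB[of "real m" "real n"] pos[of "real m"] pos[of "real n"] that by (simp add: field_simps)
  qed (use Ppos in \<open>simp_all add: PSuc\<close>)
  have concave: "0 \<le> fps_nth (gen_Turanian (\<lambda>\<mu>. fps_const (pochhammer \<mu> 2) *
      fps_hypergeo ([\<mu> / 2 + 1, \<mu> / 2 + 3 / 2] @ a) ([3 / 2] @ b) 1) x \<alpha> \<beta>) k"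
    if "0 < x" "0 \<le> \<alpha>" "0 \<le> \<beta>" for x \<alpha> \<beta> :: real and k
  proof (rule odd_turan_nonneg[OF _ _ _ _ that])
    show "(fps_const (pochhammer y 2) * fps_hypergeo ([y / 2 + 1, y / 2 + 3 / 2] @ a) ([3 / 2] @ b) 1) $ i
        = PA i / PB i * (pochhammer y (2 * i + 2) / fact (2 * i + 1))" for y :: real and i
      unfolding PA_def PB_def by (rule hypergeo_odd_nth)
    show "A (real n) / B (real n) \<le> A (real m) / B (real m)" if "m \<le> n" for m n
      using AB[of "real m" "real n"] pos[of "real m"] pos[of "real n"] that by (simp add: field_simps)
  qed (use Ppos in \<open>simp_all add: PSuc\<close>)
  show ?thesis
    using convex concave by (simp add: coeffwise_log_convex_def coeffwise_log_concave_def)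
qed

end
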